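(* Let $f:\mathbb{R}^n\to\mathbb{R}$ be twice continuously differentiable, level-bounded and convex, and let $f_\star=\inf f$. Let $\phi:\mathbb{R}^n\to\mathbb{R}\cup\{+\infty\}$ be proper, lower semicontinuous, essentially smooth and strongly convex with constant $\mu_\phi>0$, and suppose moreover that $\phi\ge 0$, $\phi$ is even, and $\phi(0)=0$. Let $x_0\in\mathbb{R}^n$ and let $x:[0,\infty)\to\mathbb{R}^n$ be the unique solution of $$\dot x(t)=-\nabla\phi^*(\nabla f(x(t))),\qquad x(0)=x_0.$$ Then: (i) $t\mapsto\phi^*(\nabla f(x(t)))$ is decreasing (i.e. nonincreasing) on $[0,\infty)$. (ii) The function $V(t):=t\,\phi^*(\nabla f(x(t)))+f(x(t))$ is monotonically decreasing (i.e. nonincreasing) on $[0,\infty)$, and consequently $$\phi^*(\nabla f(x(t)))\le\frac{f(x_0)-f_\star}{t}\qquad\text{for all } t>0.$$ Assume moreover that $\phi=h\circ\|\cdot\|$ for some $h:\mathbb{R}\to\mathbb{R}\cup\{+\infty\}$ that is proper, lower semicontinuous, essentially smooth, strongly convex, even, nonnegative and satisfies $h(0)=0$, and let $x^\star\in\operatorname{arg\,min} f$. Then: (iii) $t\mapsto\|\nabla f(x(t))\|$ and $t\mapsto\|x(t)-x^\star\|$ are decreasing (i.e. nonincreasing) on $[0,\infty)$. (iv) If, furthermore, $y\mapsto {h^*}'(y)/y$ is decreasing (i.e. nonincreasing) on $(0,\infty)$ and $\nabla f(x_0)\neq 0$, then $$f(x(t))-f_\star\le\frac{\|\nabla f(x_0)\|\,\|x_0-x^\star\|^2}{{h^*}'(\|\nabla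 f(x_0)\|)\,t}\qquad\text{for all } t>0.$$
   Context: $\|\cdot\|$ and $\langle\cdot,\cdot\rangle$ are the Euclidean norm and inner product on $\mathbb{R}^n$. $\phi^*(y)=\sup_x\{\langle x,y\rangle-\phi(x)\}$ is the convex conjugate (and $h^*$ that of $h$ on $\mathbb{R}$); under the assumptions $\phi^*$ and $h^*$ are finite and differentiable everywhere with Lipschitz gradients, and the differential equation has a unique global solution on $[0,\infty)$ for each $x_0$. $f$ is level-bounded if $\{x\in\mathbb{R}^n\mid f(x)\le\alpha\}$ is bounded for every $\alpha\in\mathbb{R}$; hence $\operatorname{arg\,min} f\neq\emptyset$. A function $g$ is even if $g(-x)=g(x)$ for all $x$. A proper, lower semicontinuous, convex function $g$ is essentially smooth if $\operatorname{int}(\operatorname{dom} g)\neq\emptyset$, $g$ is differentiable on $\operatorname{int}(\operatorname{dom} g)$, and $\|\nabla g(x^\nu)\|\to\infty$ whenever $\operatorname{int}(\operatorname{dom} g)\ni x^\nu\to x\in\operatorname{bdry}\operatorname{dom} g$, where $\operatorname{dom} g=\{x\mid g(x)<\infty\}$. *)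

theory Defs
  imports "HOL-Analysis.Analysis"
begin

definition gradient :: "('a::real_inner \<Rightarrow> real) \<Rightarrow> 'a \<Rightarrow> 'a" where
  "gradient f x = (THE D. GDERIV f x :> D)"

lemma gradient_eqI:
  assumes "GDERIV f x :> D"
  shows "gradient f x = D"
  unfolding gradient_def
proof (rule the_equality)
  fix E assume "GDERIV f x :> E"
  with assms have "(\<lambda>h. inner h E) = (\<lambda>h. inner h D)"
    unfolding gderiv_def by (rule has_derivative_unique[rotated])
  then have "inner (E - D) E = inner (E - D) D" by metis
  then have "inner (E - D) (E - D) = 0" by (simp add: inner_diff_right)
  then show "E = D" by simp
qed (fact assms)

definition twice_continuously_differentiable :: "('a::real_normed_vector \<Rightarrow> real) \<Rightarrow> bool" where
  "twice_continuously_differentiable f \<longleftrightarrow>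
    (\<exists>(f' :: 'a \<Rightarrow> 'a \<Rightarrow>\<^sub>L real) (f'' :: 'a \<Rightarrow> 'a \<Rightarrow>\<^sub>L ('a \<Rightarrow>\<^sub>L real)).
      (\<forall>x. (f has_derivative blinfun_apply (f' x)) (at x)) \<and>
      (\<forall>x. (f' has_derivative blinfun_apply (f'' x)) (at x)) \<and>
      continuous_on UNIV f'')"

definition level_bounded :: "('a::metric_space \<Rightarrow> real) \<Rightarrow> bool" where
  "level_bounded f \<longleftrightarrow> (\<forall>\<alpha>. bounded {x. f x \<le> \<alpha>})"

definition edom :: "('a \<Rightarrow> ereal) \<Rightarrow> 'a set" where
  "edom g = {x. g x < \<infinity>}"

definition proper_fun :: "('a \<Rightarrow> ereal) \<Rightarrow> bool" where
  "proper_fun g \<longleftrightarrow> (\<forall>x. g x \<noteq> -\<infinity>) \<and> edom g \<noteq> {}"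

definition lower_semicontinuous :: "('a::topological_space \<Rightarrow> ereal) \<Rightarrow> bool" where
  "lower_semicontinuous g \<longleftrightarrow> (\<forall>x. g x \<le> Liminf (at x) g)"

text \<open>In the next two definitions the endpoints \<open>u = 0\<close> and \<open>v = 0\<close> are harmless, since
  \<open>0 * \<infinity> = 0\<close> in \<^typ>\<open>ereal\<close>.  They are meant for functions that never take the
  value \<open>-\<infinity>\<close>.\<close>

definition econvex :: "('a::real_vector \<Rightarrow> ereal) \<Rightarrow> bool" where
  "econvex g \<longleftrightarrow>
    (\<forall>x y u v. 0 \<le> u \<and> 0 \<le> v \<and> u + v = 1 \<longrightarrow>
      g (u *\<^sub>R x + v *\<^sub>R y) \<le> ereal u * g x + ereal v * g y)"

definition strongly_econvex :: "real \<Rightarrow> ('a::real_normed_vector \<Rightarrow> ereal) \<Rightarrow> bool" where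
  "strongly_econvex \<mu> g \<longleftrightarrow>
    (\<forall>x y u v. 0 \<le> u \<and> 0 \<le> v \<and> u + v = 1 \<longrightarrow>
      g (u *\<^sub>R x + v *\<^sub>R y)
        \<le> ereal u * g x + ereal v * g y - ereal (\<mu> / 2 * u * v * (norm (x - y))\<^sup>2))"

text \<open>On the interior of the domain a proper function is real-valued, so
  \<^const>\<open>real_of_ereal\<close> only changes the type there.\<close>

definition essentially_smooth :: "('a::real_inner \<Rightarrow> ereal) \<Rightarrow> bool" where
  "essentially_smooth g \<longleftrightarrow>
    proper_fun g \<and> lower_semicontinuous g \<and> econvex g \<and>
    interior (edom g) \<noteq> {} \<and>
    (\<forall>x \<in> interior (edom g). (real_of_ereal \<circ> g) differentiable (at x)) \<and>
    (\<forall>X x. (\<forall>k::nat. X k \<in> interior (edom g)) \<and> X \<longlonglongrightarrow> x \<and> x \<in> frontier (edom g) \<longrightarrow>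
      filterlim (\<lambda>k. norm (gradient (real_of_ereal \<circ> g) (X k))) at_top sequentially)"

definition conjugate :: "('a::real_inner \<Rightarrow> ereal) \<Rightarrow> 'a \<Rightarrow> ereal" where
  "conjugate g y = (SUP x. ereal (inner x y) - g x)"

definition even_fun :: "('a::uminus \<Rightarrow> 'b) \<Rightarrow> bool" where
  "even_fun g \<longleftrightarrow> (\<forall>x. g (- x) = g x)"

end

theory Submission
  imports Defs
begin

text \<open>Write \<open>G\<close> for the conjugate of \<open>\<phi>\<close>, \<open>y(t) = \<nabla>f(x(t))\<close> and \<open>p(t) = \<nabla>G(y(t))\<close>, so that
  \<open>x' = - p\<close>.  Strong convexity of \<open>\<phi>\<close> makes \<open>G\<close> finite and differentiable, with \<open>\<nabla>G(y)\<close> the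
  maximiser in the definition of \<open>G(y)\<close>; moreover \<open>0 \<le> G(y) \<le> \<langle>y, \<nabla>G(y)\<rangle>\<close>.  Hence
  \<open>(G \<circ> y)' = - \<langle>H p, p\<rangle> \<le> 0\<close> with \<open>H\<close> the Hessian of \<open>f\<close>, and \<open>V' \<le> G(y) - \<langle>y, p\<rangle> \<le> 0\<close>.

  In the radial case \<open>G(y) = h*(\<bar>y\<bar>)\<close> and \<open>p = \<theta>(\<bar>y\<bar>) y\<close> with \<open>\<theta>(r) = h*'(r) / r\<close>.  As \<open>h*\<close> is
  strictly increasing on \<open>[0, \<infinity>)\<close>, the norm of \<open>y\<close> decreases along with \<open>G(y)\<close>.  If \<open>\<theta>\<close> is nonincreasing,
  then \<open>\<theta>(\<bar>y(t)\<bar>) \<ge> \<kappa> = \<theta>(\<bar>y(0)\<bar>)\<close>, and \<open>\<kappa> t (f(x) - f(x*)) + \<bar>x - x*\<bar>\<^sup>2 / 2\<close> is nonincreasing.\<close>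

section \<open>Conjugates of strongly convex functions\<close>

lemma conjugate_eq_SUP: "conjugate g y = (SUP x. ereal (inner y x) - g x)"
  by (simp add: conjugate_def inner_commute)

text \<open>Collects what \<open>\<phi>\<close> on the Euclidean space and the profile
  \<open>h\<close> on the line have in common, so that the theory of the conjugate is developed once
  and instantiated twice.\<close>

locale strongly_convex_potential =
  fixes \<phi> :: "'a::euclidean_space \<Rightarrow> ereal" and \<mu> :: real
  assumes mu_pos: "0 < \<mu>"
    and lsc: "lower_semicontinuous \<phi>"
    and strong: "strongly_econvex \<mu> \<phi>"
    and nonneg: "0 \<le> \<phi> z"
    and zero: "\<phi> 0 = 0"
begin

abbreviation conj_real :: "'a \<Rightarrow> real" where
  "conj_real \<equiv> real_of_ereal \<circ> conjugate \<phi>"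

text \<open>Strong convexity on the segment from \<open>z\<close> to \<open>p\<close> is compared
  with the affine minorant at \<open>(1 - s) z + s p\<close>. A factor \<open>1 - s\<close> cancels,
  and \<open>s\<close> tending to 1 gives the full quadratic term.\<close>

lemma quadratic_growth:
  assumes minorant: "\<And>z. ereal (inner y z - c) \<le> \<phi> z"
    and touch: "\<phi> p = ereal (inner y p - c)"
  shows "ereal (inner y z - c + \<mu> / 2 * (norm (z - p))\<^sup>2) \<le> \<phi> z"
proof (cases "\<phi> z")
  case (real a)
  have "s * (\<mu> / 2 * (norm (z - p))\<^sup>2) \<le> a - (inner y z - c)" if s: "0 < s" "s < 1" for s
  proof -
    have "\<phi> ((1 - s) *\<^sub>R z + s *\<^sub>R p) \<le> ereal (1 - s) * \<phi> z + ereal s * \<phi> p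
        - ereal (\<mu> / 2 * (1 - s) * s * (norm (z - p))\<^sup>2)"
      using strong s unfolding strongly_econvex_def by simp
    with minorant[of "(1 - s) *\<^sub>R z + s *\<^sub>R p"]
    have "ereal (inner y ((1 - s) *\<^sub>R z + s *\<^sub>R p) - c)
        \<le> ereal (1 - s) * \<phi> z + ereal s * \<phi> p - ereal (\<mu> / 2 * (1 - s) * s * (norm (z - p))\<^sup>2)"
      by (rule order_trans)
    then have "inner y ((1 - s) *\<^sub>R z + s *\<^sub>R p) - c
        \<le> (1 - s) * a + s * (inner y p - c) - \<mu> / 2 * (1 - s) * s * (norm (z - p))\<^sup>2"
      by (simp add: real touch)
    then have "(1 - s) * (s * (\<mu> / 2 * (norm (z - p))\<^sup>2)) \<le> (1 - s) * (a - (inner y z - c))"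
      by (simp add: inner_add_right algebra_simps)
    with s show ?thesis by simp
  qed
  then have "\<mu> / 2 * (norm (z - p))\<^sup>2 \<le> a - (inner y z - c)"
    by (rule field_le_mult_one_interval)
  with real show ?thesis by simp
qed (use nonneg[of z] in auto)

lemma quadratic_lower_bound: "ereal (\<mu> / 2 * (norm z)\<^sup>2) \<le> \<phi> z"
  using quadratic_growth[of 0 0 0 z] nonneg zero by (simp add: zero_ereal_def[symmetric])

text \<open>Young's inequality, weighted so that its quadratic term matches the growth of
  \<open>\<phi>\<close>.\<close>

lemma linear_le_quadratic: "inner y z \<le> \<mu> / 2 * (norm z)\<^sup>2 + (norm y)\<^sup>2 / (2 * \<mu>)"
proof -
  have "0 \<le> (norm (\<mu> *\<^sub>R z - y))\<^sup>2 / (2 * \<mu>)" using mu_pos by simp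
  also have "\<dots> = \<mu> / 2 * (norm z)\<^sup>2 + (norm y)\<^sup>2 / (2 * \<mu>) - inner y z"
    using mu_pos unfolding power2_norm_eq_inner
    by (simp add: inner_diff inner_commute field_simps)
  finally show ?thesis by simp
qed

text \<open>Finite from below by testing \<open>z = 0\<close>, from above because quadratic growth
  beats the linear term.\<close>

lemma conjugate_eq_real: "conjugate \<phi> y = ereal (conj_real y)"
proof -
  have "ereal (inner y 0) - \<phi> 0 \<le> conjugate \<phi> y"
    unfolding conjugate_eq_SUP by (intro SUP_upper) auto
  moreover have "conjugate \<phi> y \<le> ereal ((norm y)\<^sup>2 / (2 * \<mu>))"
    unfolding conjugate_eq_SUP
  proof (rule SUP_least)
    fix z
    show "ereal (inner y z) - \<phi> z \<le> ereal ((norm y)\<^sup>2 / (2 * \<mu>))"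
      using linear_le_quadratic[of y z] quadratic_lower_bound[of z] by (cases "\<phi> z") auto
  qed
  ultimately show ?thesis by (cases "conjugate \<phi> y") (auto simp: zero)
qed

lemma fenchel_young: "ereal (inner y z - conj_real y) \<le> \<phi> z"
proof -
  have "ereal (inner y z) - \<phi> z \<le> ereal (conj_real y)"
    unfolding conjugate_eq_real[symmetric] conjugate_eq_SUP by (intro SUP_upper) auto
  then show ?thesis
    using nonneg[of z] by (cases "\<phi> z") auto
qed

lemma conj_real_nonneg: "0 \<le> conj_real y"
  using fenchel_young[of y 0] by (simp add: zero)

text \<open>The converse of \<open>fenchel_young\<close>; the later upper bounds on the conjugate go
  through this rule.\<close>

lemma conj_real_leI:
  assumes "\<And>z. ereal (inner y z - c) \<le> \<phi> z"
  shows "conj_real y \<le> c"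
proof -
  have "ereal (conj_real y) \<le> ereal c"
    unfolding conjugate_eq_real[symmetric] conjugate_eq_SUP
  proof (rule SUP_least)
    fix z
    show "ereal (inner y z) - \<phi> z \<le> ereal c"
      using assms[of z] nonneg[of z] by (cases "\<phi> z") auto
  qed
  then show ?thesis by (simp only: ereal_less_eq)
qed

lemma conj_real_zero: "conj_real 0 = 0"
proof (rule antisym)
  show "conj_real 0 \<le> 0"
    by (rule conj_real_leI) (simp add: nonneg zero_ereal_def[symmetric])
qed (rule conj_real_nonneg)

text \<open>Direct method: a maximising sequence is bounded by quadratic growth, and lower
  semicontinuity makes the limit of a convergent subsequence a maximiser.\<close>

lemma conjugate_attained: "\<exists>p. \<phi> p = ereal (inner y p - conj_real y)"
proof -
  have "\<exists>z. \<phi> z < ereal (inner y z - conj_real y + 1 / Suc k)" for k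
  proof (rule ccontr)
    assume "\<not> ?thesis"
    then have "ereal (inner y z - (conj_real y - 1 / Suc k)) \<le> \<phi> z" for z
      by (simp add: not_less algebra_simps)
    from conj_real_leI[OF this] show False by simp
  qed
  then obtain Z where Z: "\<And>k. \<phi> (Z k) < ereal (inner y (Z k) - conj_real y + 1 / Suc k)"
    by metis
  have "norm (Z k) \<le> sqrt (4 / \<mu> * ((norm y)\<^sup>2 / \<mu> + 1))" for k
  proof -
    \<comment> \<open>Doubling \<open>y\<close> and halving the result uses up only
      \<open>\<mu> / 4\<close> of the growth constant \<open>\<mu> / 2\<close>, so a positive
      multiple of the squared norm survives.\<close>
    have "inner y (Z k) = inner (2 *\<^sub>R y) (Z k) / 2" by simp
    also have "\<dots> \<le> (\<mu> / 2 * (norm (Z k))\<^sup>2 + (norm (2 *\<^sub>R y))\<^sup>2 / (2 * \<mu>)) / 2"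
      by (intro divide_right_mono linear_le_quadratic) simp
    finally have 1: "inner y (Z k) \<le> \<mu> / 4 * (norm (Z k))\<^sup>2 + (norm y)\<^sup>2 / \<mu>"
      by (simp add: power_mult_distrib add_divide_distrib)
    have "ereal (\<mu> / 2 * (norm (Z k))\<^sup>2) < ereal (inner y (Z k) - conj_real y + 1 / Suc k)"
      using quadratic_lower_bound Z by (rule order_le_less_trans)
    then have "\<mu> / 2 * (norm (Z k))\<^sup>2 < inner y (Z k) - conj_real y + 1 / Suc k"
      by (simp only: less_ereal.simps)
    moreover have "1 / real (Suc k) \<le> 1" by simp
    ultimately have "\<mu> / 2 * (norm (Z k))\<^sup>2 \<le> inner y (Z k) + 1"
      using conj_real_nonneg[of y] by linarith
    with 1 have "\<mu> / 4 * (norm (Z k))\<^sup>2 \<le> (norm y)\<^sup>2 / \<mu> + 1" by linarith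
    then have "(norm (Z k))\<^sup>2 \<le> 4 / \<mu> * ((norm y)\<^sup>2 / \<mu> + 1)"
      using mu_pos by (simp add: field_simps)
    then show ?thesis by (rule real_le_rsqrt)
  qed
  then have "bounded (range Z)" by (auto simp: bounded_iff)
  then obtain p r where r: "strict_mono (r :: nat \<Rightarrow> nat)" and lim: "(Z \<circ> r) \<longlonglongrightarrow> p"
    using bounded_imp_convergent_subsequence by blast
  have rhs: "(\<lambda>k. inner y (Z (r k)) - conj_real y + 1 / Suc (r k)) \<longlonglongrightarrow> inner y p - conj_real y + 0"
    using lim LIMSEQ_subseq_LIMSEQ[OF LIMSEQ_inverse_real_of_nat r]
    by (intro tendsto_intros) (simp_all add: o_def inverse_eq_divide)
  have "c \<le> ereal (inner y p - conj_real y)" if c: "c < \<phi> p" for c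
  proof -
    have "eventually (\<lambda>w. c < \<phi> w) (at p)"
      using lsc c unfolding lower_semicontinuous_def le_Liminf_iff by blast
    \<comment> \<open>The \<open>Liminf\<close> ignores \<open>p\<close> itself, but the sequence
      may hit \<open>p\<close>; \<open>c < \<phi> p\<close> covers that point.\<close>
    then have "eventually (\<lambda>w. c < \<phi> w) (nhds p)"
      using c by (rule eventually_nhds_conv_at[THEN iffD2, OF conjI])
    then have "eventually (\<lambda>k. c < \<phi> (Z (r k))) sequentially"
      using lim unfolding filterlim_iff o_def by blast
    then have "eventually (\<lambda>k. c \<le> ereal (inner y (Z (r k)) - conj_real y + 1 / Suc (r k))) sequentially"
      by eventually_elim (use Z less_trans in \<open>blast intro: less_imp_le\<close>)
    with rhs show ?thesis
      using tendsto_lowerbound[OF tendsto_ereal[OF rhs]] by simp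
  qed
  then have "\<phi> p \<le> ereal (inner y p - conj_real y)" by (rule dense_le)
  then show ?thesis by (intro exI[of _ p] antisym fenchel_young)
qed

text \<open>Every maximiser \<open>p\<close> is the gradient: the conjugate lies between an affine
  function of slope \<open>p\<close> and that function plus a quadratic, so the remainder is of
  second order.\<close>

lemma gderiv_conj_real:
  assumes p: "\<phi> p = ereal (inner y p - conj_real y)"
  shows "GDERIV conj_real y :> p"
proof -
  have lower: "conj_real y + inner (w - y) p \<le> conj_real w" for w
    using fenchel_young[of w p] by (simp add: p inner_diff_left)
  \<comment> \<open>the conjugate of the quadratic minorant of \<open>\<phi>\<close> that touches it at \<open>p\<close>\<close>
  have upper: "conj_real w \<le> conj_real y + inner (w - y) p + (norm (w - y))\<^sup>2 / (2 * \<mu>)" for w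
  proof (rule conj_real_leI)
    fix z
    have "inner w z - (conj_real y + inner (w - y) p + (norm (w - y))\<^sup>2 / (2 * \<mu>))
        \<le> inner y z - conj_real y + \<mu> / 2 * (norm (z - p))\<^sup>2"
      using linear_le_quadratic[of "w - y" "z - p"] by (simp add: inner_diff)
    with quadratic_growth[OF fenchel_young p, of z]
    show "ereal (inner w z - (conj_real y + inner (w - y) p + (norm (w - y))\<^sup>2 / (2 * \<mu>))) \<le> \<phi> z"
      by (meson ereal_less_eq(3) order_trans)
  qed
  show ?thesis
    unfolding gderiv_def has_derivative_at
  proof
    show "bounded_linear (\<lambda>h. inner h p)" by (rule bounded_linear_inner_left)
    show "(\<lambda>h. norm (conj_real (y + h) - conj_real y - inner h p) / norm h) \<midarrow>0\<rightarrow> 0"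
    proof (rule Lim_null_comparison)
      show "\<forall>\<^sub>F h in at 0. norm (norm (conj_real (y + h) - conj_real y - inner h p) / norm h)
          \<le> norm h / (2 * \<mu>)"
      proof (intro eventually_at_filter[THEN iffD2] always_eventually allI impI)
        fix h :: 'a assume h: "h \<noteq> 0"
        have "\<bar>conj_real (y + h) - conj_real y - inner h p\<bar> \<le> (norm h)\<^sup>2 / (2 * \<mu>)"
          using lower[of "y + h"] upper[of "y + h"] by simp
        then have "\<bar>conj_real (y + h) - conj_real y - inner h p\<bar> / norm h
            \<le> ((norm h)\<^sup>2 / (2 * \<mu>)) / norm h"
          by (rule divide_right_mono) simp
        with h show "norm (norm (conj_real (y + h) - conj_real y - inner h p) / norm h) \<le> norm h / (2 * \<mu>)"
          by (simp add: power2_eq_square)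
      qed
      show "((\<lambda>h. norm h / (2 * \<mu>)) \<longlongrightarrow> 0) (at 0)"
        by (intro tendsto_divide_zero tendsto_norm_zero tendsto_ident_at)
    qed
  qed
qed

text \<open>Identifies the gradient, defined by a description operator, with the maximiser.\<close>

lemma fenchel_equality: "\<phi> (gradient conj_real y) = ereal (inner y (gradient conj_real y) - conj_real y)"
proof -
  obtain p where p: "\<phi> p = ereal (inner y p - conj_real y)"
    using conjugate_attained by blast
  then have eq: "gradient conj_real y = p" by (intro gradient_eqI gderiv_conj_real)
  show ?thesis unfolding eq by (rule p)
qed

lemma gderiv_gradient_conj_real: "GDERIV conj_real y :> gradient conj_real y"
  by (intro gderiv_conj_real fenchel_equality)

text \<open>Fenchel equality combined with \<open>\<phi> \<ge> 0\<close>. This inequality is what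
  makes \<open>V\<close> nonincreasing.\<close>

lemma conj_real_le_inner_gradient: "conj_real y \<le> inner y (gradient conj_real y)"
  using nonneg[of "gradient conj_real y"] unfolding fenchel_equality by simp

lemma gradient_conj_real_zero: "gradient conj_real 0 = 0"
  by (intro gradient_eqI gderiv_conj_real) (simp add: zero conj_real_zero[unfolded o_def])

text \<open>Convexity between \<open>y\<close> and the origin, where the conjugate vanishes.\<close>

lemma conj_real_convex_at_zero:
  assumes "0 \<le> u" "u \<le> 1"
  shows "conj_real (u *\<^sub>R y) \<le> u * conj_real y"
proof (rule conj_real_leI)
  fix z
  show "ereal (inner (u *\<^sub>R y) z - u * conj_real y) \<le> \<phi> z"
  proof (cases "\<phi> z")
    case (real a)
    then have "inner y z - conj_real y \<le> a" "0 \<le> a"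
      using fenchel_young[of y z] nonneg[of z] by auto
    with assms have "u * (inner y z - conj_real y) \<le> u * a" "u * a \<le> a"
      by (auto intro: mult_left_mono mult_left_le_one_le)
    with real show ?thesis by (simp add: right_diff_distrib)
  qed (use nonneg[of z] in auto)
qed

end


section \<open>Radial potentials\<close>

text \<open>One direction is Cauchy-Schwarz. The other tests multiples \<open>s e\<close> of a unit
  vector along \<open>y\<close>; evenness admits negative \<open>s\<close>.\<close>

lemma conjugate_comp_norm:
  fixes y :: "'a::euclidean_space" and h :: "real \<Rightarrow> ereal"
  assumes even: "even_fun h"
  shows "conjugate (h \<circ> norm) y = conjugate h (norm y)"
proof (rule antisym)
  show "conjugate (h \<circ> norm) y \<le> conjugate h (norm y)"
    unfolding conjugate_eq_SUP
  proof (rule SUP_least)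
    fix z :: 'a
    have "ereal (inner y z) - (h \<circ> norm) z \<le> ereal (inner (norm y) (norm z)) - h (norm z)"
      using norm_cauchy_schwarz[of y z] by (intro ereal_minus_mono) auto
    also have "\<dots> \<le> (SUP s. ereal (inner (norm y) s) - h s)" by (intro SUP_upper) auto
    finally show "ereal (inner y z) - (h \<circ> norm) z \<le> (SUP s. ereal (inner (norm y) s) - h s)" .
  qed
  \<comment> \<open>For \<open>y = 0\<close> any unit vector serves.\<close>
  obtain e :: 'a where e: "norm e = 1" "y = norm y *\<^sub>R e"
  proof (cases "y = 0")
    case True
    with that nonempty_Basis show ?thesis by (metis norm_Basis norm_zero scaleR_zero_left ex_in_conv)
  next
    case False
    then show ?thesis using that[of "y /\<^sub>R norm y"] by simp
  qed
  have h_abs: "h \<bar>s\<bar> = h s" for s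
    using even by (auto simp: even_fun_def abs_if)
  show "conjugate h (norm y) \<le> conjugate (h \<circ> norm) y"
    unfolding conjugate_eq_SUP
  proof (rule SUP_least)
    fix s :: real
    have "inner y e = norm y"
      using e by (metis inner_scaleR_left mult.right_neutral norm_eq_1)
    then have "ereal (inner (norm y) s) - h s = ereal (inner y (s *\<^sub>R e)) - (h \<circ> norm) (s *\<^sub>R e)"
      using e(1) by (simp add: h_abs mult.commute)
    also have "\<dots> \<le> (SUP z. ereal (inner y z) - (h \<circ> norm) z)" by (intro SUP_upper) auto
    finally show "ereal (inner (norm y) s) - h s \<le> (SUP z. ereal (inner y z) - (h \<circ> norm) z)" .
  qed
qed

text \<open>Within this locale \<open>conj_real\<close> is the conjugate of \<open>h\<close> on the
  real line.\<close>

locale smooth_even_profile = strongly_convex_potential h \<nu> for h :: "real \<Rightarrow> ereal" and \<nu> +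
  assumes smooth: "essentially_smooth h"
    and even: "even_fun h"
begin

text \<open>A finite value at some \<open>a \<noteq> 0\<close> is also taken at \<open>- a\<close>
  by evenness, and convexity fills the interval between.\<close>

lemma zero_in_interior_edom: "0 \<in> interior (edom h)"
proof -
  have ne: "interior (edom h) \<noteq> {}" and conv: "econvex h"
    using smooth by (auto simp: essentially_smooth_def)
  \<comment> \<open>A non-empty open set of reals cannot be the singleton of 0.\<close>
  then obtain a where "a \<in> interior (edom h)" "a \<noteq> 0"
    by (metis ex_in_conv insertI1 interior_singleton not_open_singleton open_interior singletonI subsetI
        subset_singletonD)
  then have fin: "h a < \<infinity>" and a: "a \<noteq> 0"
    using interior_subset by (auto simp: edom_def)
  have "h s < \<infinity>" if s: "\<bar>s\<bar> < \<bar>a\<bar>" for s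
  proof -
    have "\<bar>s / a\<bar> < 1" using s a by (simp add: abs_divide)
    then have sa: "- 1 < s / a" "s / a < 1" by linarith+
    define u where "u = (1 + s / a) / 2"
    then have u2: "2 * u = 1 + s / a" by simp
    with sa have u: "0 \<le> u" "0 \<le> 1 - u" by linarith+
    have "u *\<^sub>R a + (1 - u) *\<^sub>R (- a) = (2 * u - 1) * a" by (simp add: algebra_simps)
    also have "2 * u - 1 = s / a" using u2 by simp
    finally have comb: "u *\<^sub>R a + (1 - u) *\<^sub>R (- a) = s" using a by simp
    have "h (u *\<^sub>R a + (1 - u) *\<^sub>R (- a)) \<le> ereal u * h a + ereal (1 - u) * h (- a)"
      by (intro conv[unfolded econvex_def, rule_format]) (use u in auto)
    also have "h (- a) = h a" using even by (simp add: even_fun_def)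
    finally show ?thesis
      unfolding comb using fin nonneg[of a] by (cases "h a") (auto simp: less_le_trans)
  qed
  then have "{- \<bar>a\<bar><..<\<bar>a\<bar>} \<subseteq> edom h" by (auto simp: edom_def abs_less_iff)
  with a show ?thesis by (intro interiorI[of "{- \<bar>a\<bar><..<\<bar>a\<bar>}"]) auto
qed

text \<open>Since \<open>h\<close> is differentiable at its minimiser 0, \<open>h s = o(s)\<close>.
  Hence \<open>r * s - h s > 0\<close> for some small \<open>s > 0\<close>, and this difference
  bounds the conjugate from below.\<close>

lemma conj_real_pos:
  assumes r: "0 < r"
  shows "0 < conj_real r"
proof -
  let ?h = "real_of_ereal \<circ> h"
  have "?h differentiable (at 0)"
    using smooth zero_in_interior_edom unfolding essentially_smooth_def by blast
  then obtain D where D: "(?h has_real_derivative D) (at 0)"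
    by (auto simp: real_differentiable_def)
  \<comment> \<open>\<open>real_of_ereal\<close> sends infinity to 0, so 0 minimises
    \<open>?h\<close> even across points outside the domain.\<close>
  have "D = 0"
    by (rule DERIV_local_min[OF D, of 1]) (auto simp: zero nonneg real_of_ereal_pos)
  with D have "(\<lambda>s. ?h s / s) \<midarrow>0\<rightarrow> 0"
    by (simp add: DERIV_def zero)
  then have "((\<lambda>s. ?h s / s) \<longlongrightarrow> 0) (at_right 0)"
    by (rule filterlim_mono[OF _ order_refl at_le]) simp
  then have "eventually (\<lambda>s. ?h s / s < r) (at_right 0)"
    using r by (rule order_tendstoD)
  \<comment> \<open>By the same default, \<open>?h s < r * s\<close> bounds \<open>h s\<close> only
    for \<open>s\<close> in the domain.\<close>
  moreover have "eventually (\<lambda>s. s \<in> edom h) (at_right 0)"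
    using topological_tendstoD[OF tendsto_ident_at open_interior zero_in_interior_edom]
    by (rule eventually_mono) (use interior_subset in auto)
  moreover have "eventually (\<lambda>s::real. 0 < s) (at_right 0)"
    by (rule eventually_at_right_less)
  ultimately have "eventually (\<lambda>s. 0 < s \<and> s \<in> edom h \<and> ?h s < r * s) (at_right 0)"
    by eventually_elim (auto simp: field_simps)
  then obtain s where s: "0 < s" "s \<in> edom h" "?h s < r * s"
    using eventually_happens'[OF trivial_limit_at_right_real] by blast
  then obtain a where "h s = ereal a"
    using nonneg[of s] by (cases "h s") (auto simp: edom_def)
  with fenchel_young[of r s] s(3) show ?thesis by simp
qed

text \<open>Convexity towards 0 shrinks the positive value at \<open>b\<close> by the factor
  \<open>a / b < 1\<close>. It serves to turn comparisons of conjugate values into comparisons of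
  norms.\<close>

lemma conj_real_strict_mono:
  assumes "0 \<le> a" "a < b"
  shows "conj_real a < conj_real b"
proof -
  have "conj_real a \<le> (a / b) * conj_real b"
    using conj_real_convex_at_zero[of "a / b" b] assms by simp
  also have "\<dots> < 1 * conj_real b"
    using assms conj_real_pos[of b] by (intro mult_strict_right_mono) auto
  finally show ?thesis by simp
qed

lemma deriv_conj_real: "(conj_real has_real_derivative deriv conj_real r) (at r)"
proof -
  have "(conj_real has_real_derivative gradient conj_real r) (at r)"
    using gderiv_gradient_conj_real[of r]
    by (simp add: gderiv_def has_field_derivative_def mult.commute)
  then show ?thesis by (metis DERIV_imp_deriv)
qed

text \<open>The positive value at \<open>r\<close> is at most \<open>r\<close> times the derivative
  there.\<close>

lemma deriv_conj_real_pos: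
  assumes "0 < r"
  shows "0 < deriv conj_real r"
proof -
  have "gradient conj_real r = deriv conj_real r"
    using deriv_conj_real[of r]
    by (intro gradient_eqI) (simp add: gderiv_def has_field_derivative_def mult.commute[of _ "deriv conj_real r"])
  then have "0 < r * deriv conj_real r"
    using conj_real_le_inner_gradient[of r] conj_real_pos[OF assms] by simp
  with assms show ?thesis by (simp add: zero_less_mult_iff)
qed

lemma gradient_conjugate_comp_norm:
  fixes y :: "'b::euclidean_space"
  assumes "y \<noteq> 0"
  shows "gradient (real_of_ereal \<circ> conjugate (h \<circ> norm)) y = (deriv conj_real (norm y) / norm y) *\<^sub>R y"
proof (rule gradient_eqI)
  have "real_of_ereal \<circ> conjugate (h \<circ> norm) = (\<lambda>y::'b. conj_real (norm y))"
    by (rule ext) (simp only: o_apply conjugate_comp_norm[OF even])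
  moreover have "GDERIV (\<lambda>y. conj_real (norm y)) y :> deriv conj_real (norm y) *\<^sub>R sgn y"
    using GDERIV_norm[OF assms] deriv_conj_real by (rule GDERIV_DERIV_compose)
  ultimately show "GDERIV (real_of_ereal \<circ> conjugate (h \<circ> norm)) y :> (deriv conj_real (norm y) / norm y) *\<^sub>R y"
    by (simp only: sgn_div_norm scaleR_scaleR divide_inverse)
qed

end


section \<open>Gradients of convex functions\<close>

text \<open>Riesz representation in coordinates.\<close>

lemma gderiv_gradient:
  assumes "(f has_derivative f') (at x)"
  shows "GDERIV f x :> gradient f (x::'a::euclidean_space)"
proof -
  have lin: "linear f'" using assms by (rule has_derivative_linear)
  have "f' h = inner h (\<Sum>b\<in>Basis. f' b *\<^sub>R b)" for h
  proof -
    have "f' h = f' (\<Sum>b\<in>Basis. inner h b *\<^sub>R b)" by (simp add: euclidean_representation)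
    also have "\<dots> = (\<Sum>b\<in>Basis. inner h b * f' b)" by (simp add: linear_sum[OF lin] linear_cmul[OF lin])
    finally show ?thesis by (simp add: inner_sum_right mult.commute)
  qed
  then have "f' = (\<lambda>h. inner h (\<Sum>b\<in>Basis. f' b *\<^sub>R b))" by (rule ext)
  with assms have "GDERIV f x :> (\<Sum>b\<in>Basis. f' b *\<^sub>R b)" by (simp add: gderiv_def)
  then show ?thesis using gradient_eqI by metis
qed

text \<open>The gradient is a finite sum of values of \<open>f'\<close> at basis vectors, hence
  inherits the differentiability of \<open>f'\<close>.\<close>

lemma twice_continuously_differentiable_gradient:
  fixes f :: "'a::euclidean_space \<Rightarrow> real"
  assumes "twice_continuously_differentiable f"
  obtains "\<And>x. GDERIV f x :> gradient f x" and "\<And>x. gradient f differentiable (at x)"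
proof -
  obtain f' :: "'a \<Rightarrow> 'a \<Rightarrow>\<^sub>L real" and f'' where
    f': "\<And>x. (f has_derivative blinfun_apply (f' x)) (at x)" and
    f'': "\<And>x. (f' has_derivative blinfun_apply (f'' x)) (at x)"
    using assms unfolding twice_continuously_differentiable_def by blast
  have grad: "GDERIV f x :> gradient f x" for x
    by (rule gderiv_gradient[OF f'])
  have "blinfun_apply (f' x) b = inner b (gradient f x)" for x b
    using has_derivative_unique[OF f' grad[unfolded gderiv_def]] by simp
  then have "gradient f = (\<lambda>x. \<Sum>b\<in>Basis. f' x b *\<^sub>R b)"
    by (simp add: fun_eq_iff euclidean_representation inner_commute[of _ "gradient f _"])
  moreover have "(\<lambda>x. \<Sum>b\<in>Basis. f' x b *\<^sub>R b) differentiable (at x)" for x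
    unfolding differentiable_def
    by (rule exI) (rule has_derivative_sum has_derivative_scaleR_left
        bounded_linear.has_derivative[OF blinfun.bounded_linear_left] f'' | assumption)+
  ultimately show thesis using grad that by simp
qed

text \<open>Convexity bounds the difference quotients along the segment by \<open>f b - f a\<close>;
  then \<open>s\<close> tends to 0 from the right.\<close>

lemma convex_on_gradient_inequality:
  fixes f :: "'a::real_inner \<Rightarrow> real"
  assumes conv: "convex_on UNIV f" and D: "GDERIV f a :> D"
  shows "f a + inner (b - a) D \<le> f b"
proof -
  have line: "((\<lambda>s. f (a + s *\<^sub>R (b - a))) has_real_derivative inner (b - a) D) (at 0)"
  proof -
    have "((\<lambda>s. a + s *\<^sub>R (b - a)) has_derivative (\<lambda>s. s *\<^sub>R (b - a))) (at 0)"
      by (auto intro!: derivative_eq_intros)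
    moreover have "(f has_derivative (\<lambda>h. inner h D)) (at (a + 0 *\<^sub>R (b - a)))"
      using D by (simp add: gderiv_def)
    ultimately have "((\<lambda>s. f (a + s *\<^sub>R (b - a))) has_derivative (\<lambda>s. inner (s *\<^sub>R (b - a)) D)) (at 0)"
      by (rule has_derivative_compose)
    then show ?thesis by (simp add: has_field_derivative_def mult.commute[of _ "inner (b - a) D"])
  qed
  then have "((\<lambda>s. (f (a + s *\<^sub>R (b - a)) - f a) / s) \<longlongrightarrow> inner (b - a) D) (at_right 0)"
    by (auto simp: DERIV_def intro: filterlim_mono[OF _ order_refl at_le])
  moreover have "eventually (\<lambda>s. (f (a + s *\<^sub>R (b - a)) - f a) / s \<le> f b - f a) (at_right 0)"
    using eventually_at_right_real[of 0 1]
  proof (rule eventually_mono)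
    fix s :: real assume "s \<in> {0<..<1}"
    then have s: "0 < s" "s < 1" by auto
    have "f ((1 - s) *\<^sub>R a + s *\<^sub>R b) \<le> (1 - s) * f a + s * f b"
      using s by (intro convex_onD[OF conv]) auto
    moreover have "(1 - s) *\<^sub>R a + s *\<^sub>R b = a + s *\<^sub>R (b - a)" by (simp add: algebra_simps)
    ultimately show "(f (a + s *\<^sub>R (b - a)) - f a) / s \<le> f b - f a"
      using s by (simp add: field_simps)
  qed simp
  ultimately have "inner (b - a) D \<le> f b - f a"
    by (rule tendsto_upperbound) simp
  then show ?thesis by simp
qed

text \<open>The gradient of a convex function is monotone along lines, and the quadratic form is the
  derivative of that monotone function.\<close>

lemma convex_on_hessian_nonneg:
  fixes f :: "'a::euclidean_space \<Rightarrow> real"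
  assumes conv: "convex_on UNIV f" and grad: "\<And>x. GDERIV f x :> gradient f x"
    and H: "(gradient f has_derivative H) (at a)"
  shows "0 \<le> inner (H d) d"
proof -
  define g where "g s = inner (gradient f (a + s *\<^sub>R d)) d" for s
  have "mono g"
  proof (rule monoI)
    fix s t :: real assume st: "s \<le> t"
    show "g s \<le> g t"
    proof (cases "s = t")
      case False
      \<comment> \<open>Sum of two gradient inequalities with the points exchanged.\<close>
      have "0 \<le> inner ((t - s) *\<^sub>R d) (gradient f (a + t *\<^sub>R d)) - inner ((t - s) *\<^sub>R d) (gradient f (a + s *\<^sub>R d))"
        using convex_on_gradient_inequality[OF conv grad, of "a + s *\<^sub>R d" "a + t *\<^sub>R d"]
          convex_on_gradient_inequality[OF conv grad, of "a + t *\<^sub>R d" "a + s *\<^sub>R d"]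
        by (simp add: algebra_simps inner_diff_left)
      then have "0 \<le> (t - s) * (g t - g s)"
        by (simp add: g_def inner_commute algebra_simps)
      with st False show ?thesis by (simp add: zero_le_mult_iff)
    qed simp
  qed
  moreover have "(g has_real_derivative inner (H d) d) (at 0)"
  proof -
    have "((\<lambda>s. a + s *\<^sub>R d) has_derivative (\<lambda>s. s *\<^sub>R d)) (at 0)"
      by (auto intro!: derivative_eq_intros)
    moreover have "(gradient f has_derivative H) (at (a + 0 *\<^sub>R d))" using H by simp
    ultimately have "((\<lambda>s. gradient f (a + s *\<^sub>R d)) has_derivative (\<lambda>s. H (s *\<^sub>R d))) (at 0)"
      by (rule has_derivative_compose)
    then have "(g has_derivative (\<lambda>s. inner (H (s *\<^sub>R d)) d)) (at 0)"
      unfolding g_def by (rule has_derivative_inner_left)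
    moreover have "(\<lambda>s. inner (H (s *\<^sub>R d)) d) = (*) (inner (H d) d)"
      by (simp add: fun_eq_iff linear_cmul[OF has_derivative_linear[OF H]] mult.commute)
    ultimately show ?thesis by (simp add: has_field_derivative_def)
  qed
  ultimately show ?thesis
    by (intro mono_on_imp_deriv_nonneg[of UNIV g]) auto
qed

text \<open>A minimiser over one non-empty compact sublevel set is global. Boundedness makes the
  real \<open>INF z. f z\<close> a genuine lower bound.\<close>

lemma level_bounded_bdd_below:
  fixes f :: "'a::heine_borel \<Rightarrow> real"
  assumes lb: "level_bounded f" and cont: "continuous_on UNIV f"
  shows "bdd_below (range f)"
proof -
  fix a :: 'a
  let ?L = "{x. f x \<le> f a}"
  have "compact ?L"
    using lb cont by (auto simp: level_bounded_def compact_eq_bounded_closed intro: closed_Collect_le)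
  then obtain m where m: "m \<in> ?L" "\<And>x. x \<in> ?L \<Longrightarrow> f m \<le> f x"
    using continuous_attains_inf[of ?L f] cont continuous_on_subset by blast
  have "f m \<le> f x" for x using m(1) m(2)[of x] by (cases "f x \<le> f a") auto
  then show ?thesis by (auto simp: bdd_below_def)
qed

text \<open>The derivative at 0 is only one-sided, so the mean value argument uses two-sided
  derivatives at interior points and mere continuity at the endpoints.\<close>

lemma antimono_on_half_line_from_derivative:
  fixes g :: "real \<Rightarrow> real"
  assumes "\<And>t. 0 \<le> t \<Longrightarrow> (g has_real_derivative g' t) (at t within {0..})"
    and "\<And>t. 0 \<le> t \<Longrightarrow> g' t \<le> 0"
  shows "antimono_on {0..} g"
proof (rule monotone_onI)
  fix s t :: real assume s: "s \<in> {0..}" and st: "s \<le> t"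
  show "g t \<le> g s"
  proof (rule DERIV_nonpos_imp_decreasing_open[OF st])
    fix r assume "s < r" "r < t"
    with s have r: "0 \<le> r" "r \<in> interior {0..}" by auto
    with assms[OF r(1)] show "\<exists>y. (g has_real_derivative y) (at r) \<and> y \<le> 0"
      by (metis at_within_interior)
  next
    have "continuous_on {0..} g"
      using assms(1) DERIV_continuous by (fastforce simp: continuous_on_eq_continuous_within)
    then show "continuous_on {s..t} g" by (rule continuous_on_subset) (use s in auto)
  qed
qed


theorem mainTheorem2:
  fixes f :: "real ^ 'n \<Rightarrow> real"
    and \<phi> :: "real ^ 'n \<Rightarrow> ereal"
    and \<mu> :: real
    and x0 :: "real ^ 'n"
    and x :: "real \<Rightarrow> real ^ 'n"
  assumes f_C2: "twice_continuously_differentiable f"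
    and f_lb: "level_bounded f"
    and f_convex: "convex_on UNIV f"
    and phi_proper: "proper_fun \<phi>"
    and phi_lsc: "lower_semicontinuous \<phi>"
    and phi_smooth: "essentially_smooth \<phi>"
    and mu_pos: "\<mu> > 0"
    and phi_strong: "strongly_econvex \<mu> \<phi>"
    and phi_nonneg: "\<forall>z. 0 \<le> \<phi> z"
    and phi_even: "even_fun \<phi>"
    and phi_zero: "\<phi> 0 = 0"
    and ode: "\<forall>t\<ge>0. (x has_vector_derivative
                - gradient (real_of_ereal \<circ> conjugate \<phi>) (gradient f (x t))) (at t within {0..})"
    and init: "x 0 = x0"
  shows
    "antimono_on {0..} (\<lambda>t. conjugate \<phi> (gradient f (x t)))
     \<and>
     antimono_on {0..} (\<lambda>t. ereal t * conjugate \<phi> (gradient f (x t)) + ereal (f (x t)))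
     \<and>
     (\<forall>t>0. conjugate \<phi> (gradient f (x t)) \<le> ereal ((f x0 - (INF z. f z)) / t))
     \<and>
     (\<forall>(h :: real \<Rightarrow> ereal) xs.
        \<phi> = h \<circ> norm \<and>
        proper_fun h \<and> lower_semicontinuous h \<and> essentially_smooth h \<and>
        (\<exists>\<nu>>0. strongly_econvex \<nu> h) \<and>
        even_fun h \<and> (\<forall>r. 0 \<le> h r) \<and> h 0 = 0 \<and>
        is_arg_min f (\<lambda>_. True) xs
        \<longrightarrow>
        antimono_on {0..} (\<lambda>t. norm (gradient f (x t))) \<and>
        antimono_on {0..} (\<lambda>t. norm (x t - xs)) \<and>
        (antimono_on {0<..} (\<lambda>y. deriv (real_of_ereal \<circ> conjugate h) y / y) \<and>
         gradient f x0 \<noteq> 0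
         \<longrightarrow>
         (\<forall>t>0. f (x t) - (INF z. f z)
            \<le> norm (gradient f x0) * (norm (x0 - xs))\<^sup>2
               / (deriv (real_of_ereal \<circ> conjugate h) (norm (gradient f x0)) * t))))"
proof -
  interpret \<phi>: strongly_convex_potential \<phi> \<mu>
    by unfold_locales (use mu_pos phi_lsc phi_strong phi_nonneg phi_zero in auto)
  obtain grad: "\<And>z. GDERIV f z :> gradient f z" and diff: "\<And>z. gradient f differentiable (at z)"
    using twice_continuously_differentiable_gradient[OF f_C2] by blast
  obtain H where H: "\<And>z. (gradient f has_derivative H z) (at z)"
    using diff unfolding differentiable_def by metis
  define G where "G = \<phi>.conj_real"
  define y where "y t = gradient f (x t)" for t
  define p where "p t = gradient G (y t)" for t
  have conj_eq: "conjugate \<phi> w = ereal (G w)" for w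
    unfolding G_def by (rule \<phi>.conjugate_eq_real)
  have G_le: "G (y t) \<le> inner (y t) (p t)" and G_nonneg: "0 \<le> G (y t)" for t
    unfolding p_def G_def by (rule \<phi>.conj_real_le_inner_gradient \<phi>.conj_real_nonneg)+

  \<comment> \<open>Derivatives along the trajectory\<close>
  have x': "(x has_derivative (\<lambda>s. s *\<^sub>R (- p t))) (at t within {0..})" if "0 \<le> t" for t
    using ode that unfolding has_vector_derivative_def p_def y_def G_def by blast
  have f': "((\<lambda>t. f (x t)) has_real_derivative - inner (y t) (p t)) (at t within {0..})" if "0 \<le> t" for t
  proof -
    have "((\<lambda>t. f (x t)) has_derivative (\<lambda>s. inner (s *\<^sub>R (- p t)) (gradient f (x t)))) (at t within {0..})"
      by (rule has_derivative_compose[OF x'[OF that] grad[unfolded gderiv_def]])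
    then show ?thesis
      by (rule has_derivative_imp_has_field_derivative) (simp add: y_def inner_commute)
  qed
  have E': "((\<lambda>t. G (y t)) has_real_derivative - inner (H (x t) (p t)) (p t)) (at t within {0..})"
    if "0 \<le> t" for t
  proof -
    have 1: "(y has_derivative (\<lambda>s. H (x t) (s *\<^sub>R (- p t)))) (at t within {0..})"
      unfolding y_def by (rule has_derivative_compose[OF x'[OF that] H])
    have "(G has_derivative (\<lambda>h. inner h (p t))) (at (y t))"
      using \<phi>.gderiv_gradient_conj_real unfolding gderiv_def G_def p_def .
    with 1 have "((\<lambda>t. G (y t)) has_derivative (\<lambda>s. inner (H (x t) (s *\<^sub>R (- p t))) (p t))) (at t within {0..})"
      by (rule has_derivative_compose)
    then show ?thesis
      using has_derivative_linear[OF H, of "x t"]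
      by (elim has_derivative_imp_has_field_derivative) (simp add: linear_cmul linear_neg)
  qed
  have E'_nonpos: "- inner (H (x t) (p t)) (p t) \<le> 0" for t
    using convex_on_hessian_nonneg[OF f_convex grad H] by simp

  \<comment> \<open>Monotone quantities for a general potential\<close>
  have E_mono: "antimono_on {0..} (\<lambda>t. G (y t))"
    using E' E'_nonpos by (rule antimono_on_half_line_from_derivative)
  have f_mono: "antimono_on {0..} (\<lambda>t. f (x t))"
    using f'
  proof (rule antimono_on_half_line_from_derivative)
    show "- inner (y t) (p t) \<le> 0" for t
      using G_le[of t] G_nonneg[of t] by linarith
  qed
  have V_mono: "antimono_on {0..} (\<lambda>t. t * G (y t) + f (x t))"
  proof (rule antimono_on_half_line_from_derivative)
    fix t :: real assume t: "0 \<le> t"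
    show "((\<lambda>t. t * G (y t) + f (x t)) has_real_derivative
        G (y t) + t * (- inner (H (x t) (p t)) (p t)) - inner (y t) (p t)) (at t within {0..})"
      by (auto intro!: derivative_eq_intros E' f' t)
    show "G (y t) + t * (- inner (H (x t) (p t)) (p t)) - inner (y t) (p t) \<le> 0"
      using G_le[of t] mult_nonneg_nonpos[OF t E'_nonpos[of t]] by linarith
  qed

  have "continuous_on UNIV f"
    using grad has_derivative_continuous unfolding gderiv_def
    by (blast intro: continuous_at_imp_continuous_on)
  then have inf_le: "(INF z. f z) \<le> f w" for w
    using level_bounded_bdd_below[OF f_lb] by (intro cINF_lower) auto

  have i: "antimono_on {0..} (\<lambda>t. conjugate \<phi> (gradient f (x t)))"
    using E_mono by (auto simp: monotone_on_def conj_eq y_def)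
  have ii: "antimono_on {0..} (\<lambda>t. ereal t * conjugate \<phi> (gradient f (x t)) + ereal (f (x t)))"
    using V_mono by (auto simp: monotone_on_def conj_eq y_def)
  have ii': "conjugate \<phi> (gradient f (x t)) \<le> ereal ((f x0 - (INF z. f z)) / t)" if "0 < t" for t
  proof -
    \<comment> \<open>At time 0 the factor \<open>t\<close> removes the conjugate term from
      \<open>V\<close>.\<close>
    have "t * G (y t) + f (x t) \<le> f x0"
      using monotone_onD[OF V_mono, of 0 t] that init by simp
    with inf_le[of "x t"] have "t * G (y t) \<le> f x0 - (INF z. f z)" by linarith
    with that show ?thesis by (simp add: conj_eq y_def field_simps)
  qed

  \<comment> \<open>Radial potentials: monotone norms and the convergence rate\<close>
  have iii_iv: "antimono_on {0..} (\<lambda>t. norm (gradient f (x t))) \<and>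
        antimono_on {0..} (\<lambda>t. norm (x t - xs)) \<and>
        (antimono_on {0<..} (\<lambda>y. deriv (real_of_ereal \<circ> conjugate h) y / y) \<and>
         gradient f x0 \<noteq> 0
         \<longrightarrow>
         (\<forall>t>0. f (x t) - (INF z. f z)
            \<le> norm (gradient f x0) * (norm (x0 - xs))\<^sup>2
               / (deriv (real_of_ereal \<circ> conjugate h) (norm (gradient f x0)) * t)))"
    if radial: "\<phi> = h \<circ> norm" and "lower_semicontinuous h" and "essentially_smooth h"
      and "0 < \<nu>" and "strongly_econvex \<nu> h" and h_even: "even_fun h"
      and "\<forall>r. 0 \<le> h r" and "h 0 = 0" and "is_arg_min f (\<lambda>_. True) xs"
    for h :: "real \<Rightarrow> ereal" and xs and \<nu>
  proof -
    interpret h: smooth_even_profile h \<nu>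
      by unfold_locales (use that in auto)
    have min: "f xs \<le> f w" for w
      using that(9) by (auto simp: is_arg_min_def not_less)
    have y_mono: "norm (y t) \<le> norm (y s)" if "0 \<le> s" "s \<le> t" for s t
    proof -
      have "G w = h.conj_real (norm w)" for w
        unfolding G_def by (simp add: radial conjugate_comp_norm[OF h_even])
      with monotone_onD[OF E_mono, of s t] that
      have "h.conj_real (norm (y t)) \<le> h.conj_real (norm (y s))" by simp
      then show ?thesis
        using h.conj_real_strict_mono[of "norm (y s)" "norm (y t)"] norm_ge_zero[of "y s"]
        by (meson linorder_not_less)
    qed
    define \<theta> where "\<theta> r = deriv h.conj_real r / r" for r
    \<comment> \<open>At \<open>y t = 0\<close> both sides vanish, so the formula holds also at
      stationary points.\<close>
    have p_eq: "p t = \<theta> (norm (y t)) *\<^sub>R y t" for t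
    proof (cases "y t = 0")
      case True
      then show ?thesis unfolding p_def G_def by (simp add: \<phi>.gradient_conj_real_zero)
    next
      case False
      then show ?thesis
        unfolding p_def G_def \<theta>_def radial by (rule h.gradient_conjugate_comp_norm)
    qed
    have \<theta>_pos: "0 < \<theta> r" if "0 < r" for r
      using that h.deriv_conj_real_pos by (simp add: \<theta>_def)
    \<comment> \<open>Division by zero gives \<open>\<theta> 0 = 0\<close>.\<close>
    have \<theta>_nonneg: "0 \<le> \<theta> (norm w)" for w :: "real ^ 'n"
      using \<theta>_pos[of "norm w"] by (cases "w = 0") (auto simp: \<theta>_def)
    have gap: "f (x t) - f xs \<le> inner (y t) (x t - xs)" for t
      using convex_on_gradient_inequality[OF f_convex grad, of "x t" xs]
      by (simp add: y_def inner_commute inner_diff)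
    \<comment> \<open>Unlike the norm, the squared norm is differentiable also where
      \<open>x t = xs\<close>.\<close>
    have N': "((\<lambda>t. (norm (x t - xs))\<^sup>2 / 2) has_real_derivative
        - (\<theta> (norm (y t)) * inner (y t) (x t - xs))) (at t within {0..})" if "0 \<le> t" for t
    proof -
      have d: "((\<lambda>t. x t - xs) has_derivative (\<lambda>s. s *\<^sub>R (- p t))) (at t within {0..})"
        using has_derivative_diff[OF x'[OF that] has_derivative_const[of xs]] by simp
      have "((\<lambda>t. inner (x t - xs) (x t - xs)) has_derivative
          (\<lambda>s. inner (x t - xs) (s *\<^sub>R (- p t)) + inner (s *\<^sub>R (- p t)) (x t - xs))) (at t within {0..})"
        by (rule has_derivative_inner[OF d d])
      then have "((\<lambda>t. inner (x t - xs) (x t - xs)) has_real_derivative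
          - 2 * (\<theta> (norm (y t)) * inner (y t) (x t - xs))) (at t within {0..})"
        by (rule has_derivative_imp_has_field_derivative)
          (simp add: p_eq inner_commute algebra_simps inner_diff)
      from DERIV_cdivide[OF this, of 2] show ?thesis
        by (simp add: power2_norm_eq_inner)
    qed
    have "antimono_on {0..} (\<lambda>t. (norm (x t - xs))\<^sup>2 / 2)"
      using N'
    proof (rule antimono_on_half_line_from_derivative)
      fix t :: real
      have "0 \<le> inner (y t) (x t - xs)" using gap[of t] min[of "x t"] by linarith
      then show "- (\<theta> (norm (y t)) * inner (y t) (x t - xs)) \<le> 0"
        using \<theta>_nonneg by simp
    qed
    then have dist_mono: "antimono_on {0..} (\<lambda>t. norm (x t - xs))"
      unfolding monotone_on_def using power2_le_imp_le[OF _ norm_ge_zero] by fastforce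
    have rate: "f (x t) - (INF z. f z) \<le> norm (gradient f x0) * (norm (x0 - xs))\<^sup>2
               / (deriv h.conj_real (norm (gradient f x0)) * t)"
      if \<theta>_mono: "antimono_on {0<..} \<theta>" and ne: "gradient f x0 \<noteq> 0" and t: "0 < t" for t
    proof -
      \<comment> \<open>A lower bound for \<open>\<theta> (norm (y t))\<close> while
        \<open>y t \<noteq> 0\<close>, since the gradient norm does not increase;
        \<open>1 / \<kappa>\<close> is the factor in the claimed rate.\<close>
      define \<kappa> where "\<kappa> = \<theta> (norm (y 0))"
      have \<kappa>: "0 < \<kappa>" using ne \<theta>_pos by (simp add: \<kappa>_def y_def init)
      have "antimono_on {0..} (\<lambda>t. \<kappa> * (t * (f (x t) - f xs)) + (norm (x t - xs))\<^sup>2 / 2)"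
      proof (rule antimono_on_half_line_from_derivative)
        fix t :: real assume t: "0 \<le> t"
        show "((\<lambda>t. \<kappa> * (t * (f (x t) - f xs)) + (norm (x t - xs))\<^sup>2 / 2) has_real_derivative
            \<kappa> * (f (x t) - f xs - t * inner (y t) (p t)) - \<theta> (norm (y t)) * inner (y t) (x t - xs))
            (at t within {0..})"
          by (rule derivative_eq_intros f' N' t refl | simp add: algebra_simps)+
        have "\<kappa> * (f (x t) - f xs) \<le> \<theta> (norm (y t)) * inner (y t) (x t - xs)"
        \<comment> \<open>Here \<open>\<theta>\<close> is 0 and no longer dominates
          \<open>\<kappa>\<close>, but \<open>gap\<close> makes the left side nonpositive.\<close>
        proof (cases "y t = 0")
          case True
          with gap[of t] \<kappa> show ?thesis by (simp add: mult_nonneg_nonpos)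
        next
          case False
          then have "\<kappa> \<le> \<theta> (norm (y t))"
            using y_mono[of 0 t] t ne
            unfolding \<kappa>_def by (intro monotone_onD[OF \<theta>_mono]) (auto simp: y_def init)
          with gap[of t] min[of "x t"] \<kappa> show ?thesis by (intro mult_mono) auto
        qed
        moreover have "0 \<le> \<kappa> * (t * inner (y t) (p t))"
          using \<kappa> t G_le[of t] G_nonneg[of t] by (intro mult_nonneg_nonneg) auto
        ultimately show "\<kappa> * (f (x t) - f xs - t * inner (y t) (p t))
            - \<theta> (norm (y t)) * inner (y t) (x t - xs) \<le> 0"
          by (simp add: algebra_simps)
      qed
      from monotone_onD[OF this, of 0 t] t init
      have "\<kappa> * (t * (f (x t) - f xs)) + (norm (x t - xs))\<^sup>2 / 2 \<le> (norm (x0 - xs))\<^sup>2 / 2" by simp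
      \<comment> \<open>A factor 1/2 on the right is given away to reach the stated
        constant.\<close>
      then have "\<kappa> * (t * (f (x t) - f xs)) \<le> (norm (x0 - xs))\<^sup>2"
        using zero_le_power2[of "norm (x t - xs)"] zero_le_power2[of "norm (x0 - xs)"] by linarith
      then have "f (x t) - f xs \<le> (norm (x0 - xs))\<^sup>2 / (\<kappa> * t)"
        using \<kappa> t by (simp add: field_simps)
      moreover have "(INF z. f z) = f xs"
        using min inf_le by (intro antisym cINF_greatest) auto
      ultimately show ?thesis
        by (simp add: \<kappa>_def \<theta>_def y_def init mult.commute)
    qed
    have norm_mono: "antimono_on {0..} (\<lambda>t. norm (gradient f (x t)))"
      by (rule monotone_onI) (use y_mono in \<open>simp add: y_def\<close>)
    show ?thesis
      by (intro conjI norm_mono dist_mono impI allI, elim conjE) (rule rate[unfolded \<theta>_def])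
  qed
  show ?thesis
  proof (intro conjI i ii)
    show "\<forall>t>0. conjugate \<phi> (gradient f (x t)) \<le> ereal ((f x0 - (INF z. f z)) / t)"
      using ii' by blast
  qed (intro allI impI; elim conjE exE; rule iii_iv; assumption)
qed

end
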